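(* Let $\nu>0$ and let $k\in\{0,1,2,\dots\}$ be such that $\nu\in(k/2,(k+1)/2]$. Assume that $f(z)=\sum_{n=0}^\infty a_nz^n$ belongs to $\mathcal{B}(\nu)$ and $\|f\|_{\mathcal{B}(\nu)}\le1$. Then $$\sum_{n=0}^\infty|a_n|r^n\le1$$ for $|z|=r\le r(\nu)=\max\{r_1(\nu),r_2(k)\}$. Here $r_1(\nu)$ is the unique solution in $(0,1)$ to the equation $6(1-r^2)^{2\nu}-\pi^2r^2=0$, and $r_2(k)$ is the unique solution in $(0,1)$ to the equation $rF_k(r)-1+r=0$, where $$F_0(r)=\sum_{n=1}^\infty\frac{r^n}{n^2},\qquad F_1(r)=\log\frac1{1-r},\qquad F_k(r)=\frac1k\log\frac1{1-r}+\frac1k\sum_{n=1}^{k-1}\frac1n\left(\frac1{(1-r)^n}-1\right)\ \text{ for }k\ge2.$$ Moreover, when $\nu\ge1$, $r(\nu)$ cannot be replaced by $r_3(\nu)$ (i.e. it is not true that $\sum_{n=0}^\infty|a_n|r^n\le1$ for all $r\le r_3(\nu)$ and all $f\in\mathcal{B}(\nu)$ with $\|f\|_{\mathcal{B}(\nu)}\le1$), where $r_3(1)=0.624162$ and $$r_3(\nu)=\min\left\{0.624162,\ \sqrt{1-(2\nu-1)^{-1/(\nu-1)}}\right\}\quad\text{for }\nu>1.$$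
   Context: $\mathbb{D}$ is the open unit disk in $\mathbb{C}$. For $\nu>0$, $\mathcal{B}(\nu)$ is the space of analytic functions $f$ in $\mathbb{D}$ with $\beta_\nu(f)=\sup_{z\in\mathbb{D}}(1-|z|^2)^\nu|f'(z)|<\infty$, normed by $\|f\|_{\mathcal{B}(\nu)}=|f(0)|+\beta_\nu(f)$. *)

theory Defs
  imports "HOL-Analysis.Analysis"
begin

text \<open>
  Functions on the open unit disk are represented by total functions on the complex numbers;
  only their values on \<^term>\<open>ball (0::complex) 1\<close> are ever used.
\<close>

definition bloch_weight :: "real \<Rightarrow> (complex \<Rightarrow> complex) \<Rightarrow> complex \<Rightarrow> real" where
  "bloch_weight \<nu> f z = (1 - (cmod z)\<^sup>2) powr \<nu> * cmod (deriv f z)"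

definition bloch_space :: "real \<Rightarrow> (complex \<Rightarrow> complex) set" where
  "bloch_space \<nu> = {f. f analytic_on ball 0 1 \<and> bdd_above (bloch_weight \<nu> f ` ball 0 1)}"

text \<open>
  The real-valued supremum below is meaningful only when the weight is bounded,
  i.e. for members of \<^const>\<open>bloch_space\<close>.
\<close>

definition bloch_seminorm :: "real \<Rightarrow> (complex \<Rightarrow> complex) \<Rightarrow> real" where
  "bloch_seminorm \<nu> f = (SUP z\<in>ball 0 1. bloch_weight \<nu> f z)"

definition bloch_norm :: "real \<Rightarrow> (complex \<Rightarrow> complex) \<Rightarrow> real" where
  "bloch_norm \<nu> f = cmod (f 0) + bloch_seminorm \<nu> f"

text \<open>
  Convergence of the majorant series is demanded explicitly, since \<^const>\<open>suminf\<close> is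
  unspecified for divergent series.
\<close>

definition bohr_inequality_upto :: "real \<Rightarrow> real \<Rightarrow> bool" where
  "bohr_inequality_upto \<nu> R \<longleftrightarrow>
     (\<forall>(f :: complex \<Rightarrow> complex) (a :: nat \<Rightarrow> complex) (r :: real).
        f \<in> bloch_space \<nu> \<and> bloch_norm \<nu> f \<le> 1 \<and>
        (\<forall>z\<in>ball 0 1. (\<lambda>n. a n * z ^ n) sums f z) \<and>
        0 \<le> r \<and> r \<le> R
        \<longrightarrow> summable (\<lambda>n. cmod (a n) * r ^ n) \<and> (\<Sum>n. cmod (a n) * r ^ n) \<le> 1)"

definition bohr_F :: "nat \<Rightarrow> real \<Rightarrow> real" where
  "bohr_F k r =
     (if k = 0 then (\<Sum>n. r ^ Suc n / (real (Suc n))\<^sup>2)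
      else if k = 1 then ln (1 / (1 - r))
      else 1 / real k * ln (1 / (1 - r))
           + 1 / real k * (\<Sum>n = 1..k - 1. 1 / real n * (1 / (1 - r) ^ n - 1)))"

definition r1_root :: "real \<Rightarrow> real \<Rightarrow> bool" where
  "r1_root \<nu> r \<longleftrightarrow> 0 < r \<and> r < 1 \<and> 6 * (1 - r\<^sup>2) powr (2 * \<nu>) - pi\<^sup>2 * r\<^sup>2 = 0"

definition r2_root :: "nat \<Rightarrow> real \<Rightarrow> bool" where
  "r2_root k r \<longleftrightarrow> 0 < r \<and> r < 1 \<and> r * bohr_F k r - 1 + r = 0"

definition r1 :: "real \<Rightarrow> real" where
  "r1 \<nu> = (THE r. r1_root \<nu> r)"

definition r2 :: "nat \<Rightarrow> real" where
  "r2 k = (THE r. r2_root k r)"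

definition r3 :: "real \<Rightarrow> real" where
  "r3 \<nu> = (if \<nu> = 1 then 0.624162
           else min 0.624162 (sqrt (1 - (2 * \<nu> - 1) powr (- 1 / (\<nu> - 1)))))"

end

theory Submission
  imports Defs "HOL-Complex_Analysis.Cauchy_Integral_Formula"
begin

text \<open>
  Let \<open>\<beta>\<close> be the seminorm of \<open>f\<close>. Parseval on circles gives
  \<open>\<Sum> n\<^sup>2 |a\<^sub>n|\<^sup>2 x^(n-1) \<le> \<beta>\<^sup>2 (1 - x)^(-2\<nu>)\<close>, and it remains to see that
  \<open>\<Sum> |a\<^sub>n| r\<^sup>n \<le> \<beta>\<close> for the sum over \<open>n \<ge> 1\<close>. For \<open>r \<le> r\<^sub>1(\<nu>)\<close> take \<open>x = r\<^sup>2\<close> and apply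
  Cauchy-Schwarz with \<open>\<Sum> 1/n\<^sup>2 = \<pi>\<^sup>2/6\<close>. For \<open>r \<le> r\<^sub>2(k)\<close> replace \<open>2\<nu>\<close> by \<open>k + 1\<close>: if \<open>k = 0\<close> take
  \<open>x = r\<close>, and if \<open>k \<ge> 1\<close> integrate twice to get \<open>\<Sum> |a\<^sub>n|\<^sup>2 r\<^sup>n \<le> \<beta>\<^sup>2 F\<^sub>k(r)\<close>, then apply
  Cauchy-Schwarz with a geometric series.

  The bounds on the radius come from the square of a disk automorphism, which has seminorm at most 1
  for every \<open>\<nu> \<ge> 1\<close>, and from the primitive of \<open>(1 - z\<^sup>2)^(-\<nu>)\<close>.
\<close>

section \<open>Parseval on circles through roots of unity\<close>

text \<open>The ratio of the geometric sum is an \<open>M\<close>-th root of unity, and it differs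
  from 1 because the powers of \<open>w\<close> with exponents below \<open>M\<close> are
  distinct.\<close>

lemma sum_powers_cis_eq_0:
  fixes M m n :: nat
  assumes "m < M" "n < M" "m \<noteq> n"
  defines "w \<equiv> cis (2 * pi / real M)"
  shows "(\<Sum>j<M. (w ^ m * cnj w ^ n) ^ j) = 0"
proof -
  let ?q = "w ^ m * cnj w ^ n"
  have w: "w * cnj w = 1" unfolding w_def by (simp add: cis_cnj cis_mult)
  have wM: "w ^ M = 1"
    using assms(1) unfolding w_def by (subst Complex.DeMoivre) simp
  have "?q \<noteq> 1"
  proof
    assume "?q = 1"
    moreover have "?q * w ^ n = w ^ m"
      using w by (metis mult.assoc mult.commute mult.right_neutral power_mult_distrib power_one)
    ultimately have "w ^ m = w ^ n" by simp
    then have "cis (2 * pi * real m / real M) = cis (2 * pi * real n / real M)"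
      by (simp add: w_def Complex.DeMoivre mult_ac)
    moreover have "inj_on (\<lambda>k. cis (2 * pi * real k / real M)) {..<M}"
      using Complex.bij_betw_roots_unity[of M] assms(1) by (simp add: bij_betw_def)
    ultimately have "m = n" using assms(1,2) by (auto dest: inj_onD)
    with assms(3) show False by simp
  qed
  moreover have "?q ^ M = 1"
  proof -
    have "?q ^ M = (w ^ M) ^ m * cnj (w ^ M) ^ n"
      by (simp add: power_mult_distrib flip: power_mult) (simp add: mult.commute)
    then show ?thesis by (simp add: wM)
  qed
  ultimately show ?thesis by (simp add: sum_gp_strict)
qed

text \<open>Expanding the squared modulus and exchanging sums leaves only the diagonal terms, by
  orthogonality. Averaging over \<open>M\<close> sample points takes the place of the integral over
  the circle.\<close>

lemma discrete_Parseval: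
  fixes c :: "nat \<Rightarrow> complex" and M :: nat
  defines "w \<equiv> cis (2 * pi / real M)"
  shows "(\<Sum>j<M. (cmod (\<Sum>n<M. c n * (w ^ j) ^ n))\<^sup>2) = real M * (\<Sum>n<M. (cmod (c n))\<^sup>2)"
proof -
  have w: "w * cnj w = 1" unfolding w_def by (simp add: cis_cnj cis_mult)
  have "complex_of_real (\<Sum>j<M. (cmod (\<Sum>n<M. c n * (w ^ j) ^ n))\<^sup>2)
      = (\<Sum>j<M. (\<Sum>m<M. c m * (w ^ j) ^ m) * (\<Sum>n<M. cnj (c n) * cnj ((w ^ j) ^ n)))"
    by (simp add: complex_norm_square del: of_real_power)
  also have "\<dots> = (\<Sum>j<M. \<Sum>m<M. \<Sum>n<M. c m * cnj (c n) * (w ^ m * cnj w ^ n) ^ j)"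
    by (simp add: sum_product power_mult_distrib mult_ac flip: power_mult)
  also have "\<dots> = (\<Sum>m<M. \<Sum>n<M. \<Sum>j<M. c m * cnj (c n) * (w ^ m * cnj w ^ n) ^ j)"
    by (subst sum.swap, rule sum.cong[OF refl], rule sum.swap)
  also have "\<dots> = (\<Sum>m<M. \<Sum>n<M. c m * cnj (c n) * (\<Sum>j<M. (w ^ m * cnj w ^ n) ^ j))"
    by (simp add: sum_distrib_left)
  also have "\<dots> = (\<Sum>m<M. \<Sum>n<M. if n = m then c m * cnj (c m) * of_nat M else 0)"
  proof (intro sum.cong refl)
    fix m n assume "m \<in> {..<M}" "n \<in> {..<M}"
    then show "c m * cnj (c n) * (\<Sum>j<M. (w ^ m * cnj w ^ n) ^ j)
        = (if n = m then c m * cnj (c m) * of_nat M else 0)"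
      using sum_powers_cis_eq_0[of m M n] w
      by (auto simp: w_def simp flip: power_mult_distrib)
  qed
  also have "\<dots> = (\<Sum>m<M. c m * cnj (c m) * of_nat M)"
    by (intro sum.cong refl) simp
  also have "\<dots> = complex_of_real (real M * (\<Sum>n<M. (cmod (c n))\<^sup>2))"
    by (simp add: complex_norm_square sum_distrib_left mult_ac del: of_real_power)
  finally show ?thesis using of_real_eq_iff by blast
qed

text \<open>On the circle a long enough partial sum of the series differs from \<open>g\<close> by
  at most \<open>e\<close>. Discrete Parseval, applied to this polynomial, gives the bound with
  \<open>B + e\<close>, and then \<open>e\<close> tends to 0.\<close>

lemma sum_norm_sq_le_of_circle_bound:
  fixes b :: "nat \<Rightarrow> complex" and g :: "complex \<Rightarrow> complex" and \<rho> B :: real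
  assumes summ: "summable (\<lambda>n. cmod (b n) * \<rho> ^ n)"
    and sums: "\<And>z. cmod z = \<rho> \<Longrightarrow> (\<lambda>n. b n * z ^ n) sums g z"
    and bound: "\<And>z. cmod z = \<rho> \<Longrightarrow> cmod (g z) \<le> B"
    and "0 \<le> \<rho>"
  shows "(\<Sum>n<N. (cmod (b n))\<^sup>2 * \<rho> ^ (2 * n)) \<le> B\<^sup>2"
proof -
  have B0: "0 \<le> B" using bound[of "of_real \<rho>"] \<open>0 \<le> \<rho>\<close> norm_ge_zero order_trans
    by (metis abs_of_nonneg norm_of_real)
  define S where "S = (\<Sum>n<N. (cmod (b n))\<^sup>2 * \<rho> ^ (2 * n))"
  have le: "S \<le> (B + e)\<^sup>2" if e: "e > 0" for e
  proof -
    obtain M0 where M0: "\<And>m. m \<ge> M0 \<Longrightarrow> norm (\<Sum>i. cmod (b (i + m)) * \<rho> ^ (i + m)) < e"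
      using suminf_exist_split[OF e summ] by metis
    \<comment> \<open>Beyond \<open>M0\<close> the tail is below \<open>e\<close>; beyond
      \<open>N\<close> the sum \<open>S\<close> is part of the Parseval sum. The successor keeps
      \<open>M\<close> positive, so that the factor \<open>real M\<close> cancels at the
      end.\<close>
    define M where "M = Suc (max M0 N)"
    define w where "w = cis (2 * pi / real M)"
    have close: "cmod (\<Sum>n<M. b n * z ^ n) \<le> B + e" if z: "cmod z = \<rho>" for z
    proof -
      have sm: "summable (\<lambda>n. cmod (b n * z ^ n))"
        using summ z by (simp add: norm_mult norm_power)
      then have sm': "summable (\<lambda>n. cmod (b (n + M) * z ^ (n + M)))"
        by (subst summable_iff_shift)
      have "g z = (\<Sum>n. b (n + M) * z ^ (n + M)) + (\<Sum>n<M. b n * z ^ n)"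
        using suminf_split_initial_segment[of "\<lambda>n. b n * z ^ n" M] sums[OF z]
        by (simp add: sums_iff)
      then have "cmod (\<Sum>n<M. b n * z ^ n) \<le> cmod (g z) + cmod (\<Sum>n. b (n + M) * z ^ (n + M))"
        by (metis add_diff_cancel_left' norm_triangle_ineq4)
      also have "cmod (\<Sum>n. b (n + M) * z ^ (n + M)) \<le> (\<Sum>n. cmod (b (n + M) * z ^ (n + M)))"
        by (rule summable_norm[OF sm'])
      also have "\<dots> = (\<Sum>i. cmod (b (i + M)) * \<rho> ^ (i + M))"
        using z by (simp add: norm_mult norm_power)
      also have "\<dots> \<le> e"
      proof -
        have "M0 \<le> M" by (simp add: M_def)
        from M0[OF this] show ?thesis by simp
      qed
      finally show ?thesis using bound[OF z] by simp
    qed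
    have "real M * S \<le> real M * (\<Sum>n<M. (cmod (b n * of_real \<rho> ^ n))\<^sup>2)"
    proof -
      have "S \<le> (\<Sum>n<M. (cmod (b n))\<^sup>2 * \<rho> ^ (2 * n))"
        unfolding S_def M_def using \<open>0 \<le> \<rho>\<close> by (intro sum_mono2) auto
      also have "\<dots> = (\<Sum>n<M. (cmod (b n * of_real \<rho> ^ n))\<^sup>2)"
        using \<open>0 \<le> \<rho>\<close> by (simp add: norm_mult norm_power power_mult_distrib power_even_eq)
      finally show ?thesis by (simp add: mult_left_mono)
    qed
    also have "\<dots> = (\<Sum>j<M. (cmod (\<Sum>n<M. (b n * of_real \<rho> ^ n) * (w ^ j) ^ n))\<^sup>2)"
      unfolding w_def by (rule discrete_Parseval[symmetric])
    also have "\<dots> = (\<Sum>j<M. (cmod (\<Sum>n<M. b n * (of_real \<rho> * w ^ j) ^ n))\<^sup>2)"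
      by (simp add: power_mult_distrib mult_ac)
    also have "\<dots> \<le> (\<Sum>j<M. (B + e)\<^sup>2)"
      using \<open>0 \<le> \<rho>\<close>
      by (intro sum_mono power_mono close) (auto simp: norm_mult norm_power w_def)
    finally show ?thesis by (simp add: M_def)
  qed
  have "eventually (\<lambda>e. S \<le> (B + e)\<^sup>2) (at_right 0)"
    by (rule eventually_mono[OF eventually_at_right_less]) (rule le)
  moreover have "((\<lambda>e. (B + e)\<^sup>2) \<longlongrightarrow> (B + 0)\<^sup>2) (at_right 0)"
    by (intro tendsto_intros)
  ultimately show ?thesis
    unfolding S_def[symmetric] by (metis add.right_neutral tendsto_lowerbound trivial_limit_at_right_real)
qed

section \<open>Coefficient estimate from the Bloch seminorm\<close>

lemma bloch_weight_le_seminorm: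
  assumes "f \<in> bloch_space \<nu>" "z \<in> ball 0 1"
  shows "bloch_weight \<nu> f z \<le> bloch_seminorm \<nu> f"
  using assms unfolding bloch_space_def bloch_seminorm_def by (auto intro: cSUP_upper)

text \<open>The Taylor coefficients of f' are \<open>diffs a\<close>, and on the circle of radius
  sqrt x the seminorm bounds |f'|. The circle estimate then applies, with even powers of the radius
  turning into powers of \<open>x\<close>.\<close>

lemma bloch_coefficient_sum_le:
  assumes f: "f \<in> bloch_space \<nu>"
    and sums: "\<And>z. z \<in> ball 0 1 \<Longrightarrow> (\<lambda>n. a n * z ^ n) sums f z"
    and x: "0 \<le> x" "x < 1"
  shows "(\<Sum>n<N. (real (Suc n))\<^sup>2 * (cmod (a (Suc n)))\<^sup>2 * x ^ n)
      \<le> (bloch_seminorm \<nu> f)\<^sup>2 * (1 - x) powr (- 2 * \<nu>)"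
proof -
  define \<rho> where "\<rho> = sqrt x"
  have \<rho>: "0 \<le> \<rho>" "\<rho> < 1" "\<rho>\<^sup>2 = x" using x by (auto simp: \<rho>_def)
  have summ: "summable (\<lambda>n. a n * z ^ n)" if "norm z < 1" for z
    using sums[of z] that by (auto simp: sums_iff)
  have deriv: "(f has_field_derivative (\<Sum>n. diffs a n * z ^ n)) (at z)" if z: "norm z < 1" for z
  proof -
    have "((\<lambda>z. \<Sum>n. a n * z ^ n) has_field_derivative (\<Sum>n. diffs a n * z ^ n)) (at z)"
      by (rule termdiffs_strong'[OF summ z])
    then show ?thesis
      by (rule has_field_derivative_transform_within_open[where S = "ball 0 1"])
        (use z sums in \<open>auto simp: sums_iff\<close>)
  qed
  have dsumm: "summable (\<lambda>n. diffs a n * z ^ n)" if "norm z < 1" for z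
    by (rule termdiff_converges[OF that summ])
  have "(\<Sum>n<N. (cmod (diffs a n))\<^sup>2 * \<rho> ^ (2 * n))
      \<le> (bloch_seminorm \<nu> f * (1 - \<rho>\<^sup>2) powr (- \<nu>))\<^sup>2"
  proof (rule sum_norm_sq_le_of_circle_bound)
    \<comment> \<open>Convergence at a point of larger modulus \<open>s\<close> yields absolute
      convergence at radius \<open>\<rho>\<close>.\<close>
    obtain s where s: "\<rho> < s" "s < 1" using dense[OF \<rho>(2)] by blast
    have "summable (\<lambda>n. diffs a n * of_real s ^ n)" using s \<rho> by (intro dsumm) simp
    then have "summable (\<lambda>n. norm (diffs a n * of_real \<rho> ^ n))"
      by (rule powser_insidea) (use s \<rho> in simp)
    then show "summable (\<lambda>n. cmod (diffs a n) * \<rho> ^ n)"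
      using \<rho> by (simp add: norm_mult norm_power)
  next
    fix z :: complex assume z: "cmod z = \<rho>"
    then have z1: "norm z < 1" using \<rho> by simp
    have d: "deriv f z = (\<Sum>n. diffs a n * z ^ n)" using deriv[OF z1] by (rule DERIV_imp_deriv)
    show "(\<lambda>n. diffs a n * z ^ n) sums deriv f z"
      unfolding d using dsumm[OF z1] by (rule summable_sums)
    have "bloch_weight \<nu> f z \<le> bloch_seminorm \<nu> f"
      using f z1 by (intro bloch_weight_le_seminorm) auto
    then have "(1 - \<rho>\<^sup>2) powr \<nu> * cmod (deriv f z) \<le> bloch_seminorm \<nu> f"
      by (simp add: bloch_weight_def z)
    moreover have "1 - \<rho>\<^sup>2 > 0" using \<rho> x by simp
    ultimately show "cmod (deriv f z) \<le> bloch_seminorm \<nu> f * (1 - \<rho>\<^sup>2) powr (- \<nu>)"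
      by (simp add: powr_minus field_simps)
  qed (use \<rho> in simp)
  moreover have "((1 - x) powr (- \<nu>))\<^sup>2 = (1 - x) powr (- 2 * \<nu>)"
    by (simp add: power2_eq_square flip: powr_add)
  ultimately show ?thesis
    by (simp add: diffs_def norm_mult power_mult_distrib power_mult \<rho> del: of_nat_Suc)
qed

section \<open>Existence and uniqueness of the root r1\<close>

text \<open>The intermediate value theorem on \<open>{a..b}\<close> gives a root, and monotonicity
  up to \<open>c\<close> makes it unique. The two right ends are kept apart because F_k is unbounded
  near 1 for k at least 1.\<close>

lemma ex1_root_strict_mono:
  fixes h :: "real \<Rightarrow> real"
  assumes "continuous_on {a..b} h" "a < b" "h a < 0" "0 < h b"
    and mono: "\<And>x y. a < x \<Longrightarrow> x < y \<Longrightarrow> y < c \<Longrightarrow> h x < h y" and "b \<le> c"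
  shows "\<exists>!r. a < r \<and> r < c \<and> h r = 0"
proof -
  obtain r where "a \<le> r" "r \<le> b" "h r = 0"
    using IVT'[of h a 0 b] assms by fastforce
  moreover have "r \<noteq> a" "r \<noteq> b" using \<open>h r = 0\<close> assms by auto
  ultimately have r: "a < r" "r < c" "h r = 0" using assms by auto
  then show ?thesis
    by (metis linorder_neqE_linordered_idom mono order_less_irrefl)
qed

lemma r1_function_strict_mono:
  fixes \<nu> :: real
  assumes "0 \<le> x" "x < y" "y < 1" "0 < \<nu>"
  shows "6 * (1 - y\<^sup>2) powr (2 * \<nu>) - pi\<^sup>2 * y\<^sup>2 < 6 * (1 - x\<^sup>2) powr (2 * \<nu>) - pi\<^sup>2 * x\<^sup>2"
proof -
  have "x\<^sup>2 < y\<^sup>2" "y\<^sup>2 < 1" using assms by (auto intro: power_strict_mono simp: abs_square_less_1)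
  then have "(1 - y\<^sup>2) powr (2 * \<nu>) < (1 - x\<^sup>2) powr (2 * \<nu>)"
    using assms by (intro powr_less_mono2) auto
  moreover have "pi\<^sup>2 * x\<^sup>2 < pi\<^sup>2 * y\<^sup>2" using \<open>x\<^sup>2 < y\<^sup>2\<close> by simp
  ultimately show ?thesis by linarith
qed

lemma ex1_r1_root:
  assumes "0 < \<nu>"
  shows "\<exists>!r. r1_root \<nu> r"
proof -
  \<comment> \<open>The sign of the equation is reversed to obtain an increasing function.\<close>
  have "\<exists>!r. 0 < r \<and> r < 1 \<and> pi\<^sup>2 * r\<^sup>2 - 6 * (1 - r\<^sup>2) powr (2 * \<nu>) = 0"
  proof (rule ex1_root_strict_mono[where b = 1])
    show "continuous_on {0..1} (\<lambda>r. pi\<^sup>2 * r\<^sup>2 - 6 * (1 - r\<^sup>2) powr (2 * \<nu>))"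
      using assms by (intro continuous_intros continuous_on_powr') (auto simp: abs_square_le_1)
  next
    fix x y :: real assume "0 < x" "x < y" "y < 1"
    with r1_function_strict_mono[of x y \<nu>] assms
    show "pi\<^sup>2 * x\<^sup>2 - 6 * (1 - x\<^sup>2) powr (2 * \<nu>) < pi\<^sup>2 * y\<^sup>2 - 6 * (1 - y\<^sup>2) powr (2 * \<nu>)"
      by simp
  qed auto
  moreover have "r1_root \<nu> r \<longleftrightarrow> 0 < r \<and> r < 1 \<and> pi\<^sup>2 * r\<^sup>2 - 6 * (1 - r\<^sup>2) powr (2 * \<nu>) = 0" for r
    unfolding r1_root_def by linarith
  ultimately show ?thesis by simp
qed

text \<open>By monotonicity the equation at the root becomes an inequality below it, in the form
  that Cauchy-Schwarz will require.\<close>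

lemma le_r1_imp:
  assumes "0 < \<nu>" "0 \<le> r" "r \<le> r1 \<nu>"
  shows "r < 1" "pi\<^sup>2 * r\<^sup>2 \<le> 6 * (1 - r\<^sup>2) powr (2 * \<nu>)"
proof -
  have root: "r1_root \<nu> (r1 \<nu>)"
    unfolding r1_def by (rule theI'[OF ex1_r1_root[OF assms(1)]])
  then show "r < 1" using assms by (simp add: r1_root_def)
  show "pi\<^sup>2 * r\<^sup>2 \<le> 6 * (1 - r\<^sup>2) powr (2 * \<nu>)"
    using root r1_function_strict_mono[of r "r1 \<nu>" \<nu>] assms
    by (cases "r = r1 \<nu>") (auto simp: r1_root_def)
qed

section \<open>The functions F_k and the root r2\<close>

lemma bohr_F_0: "bohr_F 0 r = (\<Sum>n. r ^ Suc n / (real (Suc n))\<^sup>2)"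
  by (simp add: bohr_F_def)

lemma bohr_F_pos:
  assumes "0 < k"
  shows "bohr_F k r = 1 / real k * (ln (1 / (1 - r)) + (\<Sum>n = 1..k - 1. 1 / real n * (1 / (1 - r) ^ n - 1)))"
  using assms by (simp add: bohr_F_def distrib_left)

lemma summable_inverse_squares_Suc: "summable (\<lambda>n. 1 / (real (Suc n))\<^sup>2)"
  using inverse_squares_sums by (simp add: sums_iff add.commute)

lemma summable_bohr_F_0:
  assumes "0 \<le> r" "r \<le> 1"
  shows "summable (\<lambda>n. r ^ Suc n / (real (Suc n))\<^sup>2)"
  by (rule summable_comparison_test'[OF summable_inverse_squares_Suc, of 0])
    (use assms in \<open>auto simp: divide_simps power_le_one simp del: of_nat_Suc power_Suc\<close>)

lemma has_field_derivative_inverse_power: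
  fixes x :: real
  assumes "x < 1"
  shows "((\<lambda>x. 1 / (1 - x) ^ n) has_field_derivative real n * (1 / (1 - x) ^ Suc n)) (at x)"
proof -
  have "((\<lambda>x. 1 / (1 - x)) has_field_derivative (1 / (1 - x))\<^sup>2) (at x)"
    using assms by (auto intro!: derivative_eq_intros simp: field_simps power2_eq_square)
  from DERIV_power[OF this, of n] show ?thesis
    by (cases n) (simp_all add: power_one_over power2_eq_square mult_ac)
qed

text \<open>Away from 0 the derivative is ((1 - x)^(-k) - 1) / (k x) in disguise; written as a
  geometric sum it also makes sense at 0.\<close>

lemma has_field_derivative_bohr_F:
  assumes "0 < k" "x < 1"
  shows "(bohr_F k has_field_derivative (1 / real k * (\<Sum>j=1..k. 1 / (1 - x) ^ j))) (at x)"
proof -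
  have "((\<lambda>x. 1 / real n * (1 / (1 - x) ^ n - 1)) has_field_derivative 1 / (1 - x) ^ Suc n) (at x)"
    if "n \<in> {1..k - 1}" for n
  proof -
    have "((\<lambda>x. 1 / real n * (1 / (1 - x) ^ n - 1)) has_field_derivative
        1 / real n * (real n * (1 / (1 - x) ^ Suc n) - 0)) (at x)"
      by (intro DERIV_cmult DERIV_diff DERIV_const
          has_field_derivative_inverse_power assms)
    then show ?thesis using that by simp
  qed
  then have "((\<lambda>x. \<Sum>n = 1..k - 1. 1 / real n * (1 / (1 - x) ^ n - 1))
      has_field_derivative (\<Sum>n = 1..k - 1. 1 / (1 - x) ^ Suc n)) (at x)"
    by (intro DERIV_sum)
  moreover have "((\<lambda>x. ln (1 / (1 - x))) has_field_derivative 1 / (1 - x)) (at x)"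
  proof -
    have "((\<lambda>x. 1 / (1 - x)) has_field_derivative (1 / (1 - x))\<^sup>2) (at x)"
      using has_field_derivative_inverse_power[OF assms(2), of 1]
      by (simp add: power2_eq_square)
    from DERIV_chain'[OF this DERIV_ln] show ?thesis
      using assms by (simp add: power2_eq_square)
  qed
  ultimately have "((\<lambda>x. 1 / real k * (ln (1 / (1 - x)) + (\<Sum>n = 1..k - 1. 1 / real n * (1 / (1 - x) ^ n - 1))))
      has_field_derivative 1 / real k * (1 / (1 - x) + (\<Sum>n = 1..k - 1. 1 / (1 - x) ^ Suc n))) (at x)"
    by (intro DERIV_cmult DERIV_add)
  \<comment> \<open>The logarithm contributes the term j = 1, and the summand with index n
    contributes j = n + 1.\<close>
  moreover have "1 / (1 - x) + (\<Sum>n = 1..k - 1. 1 / (1 - x) ^ Suc n) = (\<Sum>j=1..k. 1 / (1 - x) ^ j)"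
  proof -
    obtain m where "k = Suc m" using assms(1) gr0_implies_Suc by blast
    then show ?thesis
      using sum.atLeast_Suc_atMost[of 1 "Suc m" "\<lambda>j. 1 / (1 - x) ^ j"]
        sum.shift_bounds_cl_Suc_ivl[of "\<lambda>j. 1 / (1 - x) ^ j" 1 m]
      by (simp del: sum.cl_ivl_Suc)
  qed
  moreover have "bohr_F k = (\<lambda>r. 1 / real k * (ln (1 / (1 - r)) + (\<Sum>n = 1..k - 1. 1 / real n * (1 / (1 - r) ^ n - 1))))"
    using bohr_F_pos[OF assms(1)] by blast
  ultimately show ?thesis by simp
qed

lemma bohr_F_mono:
  assumes "0 \<le> x" "x \<le> y" "y < 1"
  shows "bohr_F k x \<le> bohr_F k y"
proof (cases "k = 0")
  case True
  show ?thesis unfolding True bohr_F_0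
    by (rule suminf_le)
      (use assms in \<open>auto intro!: summable_bohr_F_0 divide_right_mono power_mono simp del: of_nat_Suc power_Suc\<close>)
next
  case False
  have "1 / real k * (\<Sum>j=1..k. 1 / (1 - z) ^ j) \<ge> 0" if "z \<le> y" for z
    using that assms by (intro mult_nonneg_nonneg sum_nonneg) auto
  moreover have "(bohr_F k has_field_derivative (1 / real k * (\<Sum>j=1..k. 1 / (1 - z) ^ j))) (at z)"
    if "z \<le> y" for z
    using that assms False by (intro has_field_derivative_bohr_F) auto
  ultimately show ?thesis
    by (intro DERIV_nonneg_imp_nondecreasing[OF assms(2)]) blast
qed

lemma bohr_F_at_0: "bohr_F k 0 = 0"
  by (simp add: bohr_F_def)

text \<open>For \<open>k = 0\<close> the bound is the first term of the series; otherwise F_k' is an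
  average of \<open>k\<close> numbers that are at least 1. It serves both for nonnegativity and for
  locating the root.\<close>

lemma bohr_F_ge:
  assumes "0 \<le> r" "r < 1"
  shows "r \<le> bohr_F k r"
proof (cases "k = 0")
  case True
  have "(\<Sum>n<1. r ^ Suc n / (real (Suc n))\<^sup>2) \<le> bohr_F 0 r"
    unfolding bohr_F_0 using assms
    by (intro sum_le_suminf summable_bohr_F_0) (auto simp del: of_nat_Suc)
  then show ?thesis by (simp add: True)
next
  case False
  have "(bohr_F k 0 - 0) \<le> bohr_F k r - r"
  proof (rule DERIV_nonneg_imp_nondecreasing[OF assms(1)])
    fix x assume x: "0 \<le> x" "x \<le> r"
    have "((\<lambda>x. bohr_F k x - x) has_field_derivative (1 / real k * (\<Sum>j=1..k. 1 / (1 - x) ^ j) - 1)) (at x)"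
      using False x assms by (intro DERIV_diff has_field_derivative_bohr_F) auto
    moreover have "real k \<le> (\<Sum>j=1..k. 1 / (1 - x) ^ j)"
    proof -
      have "(\<Sum>j=1..k. (1::real)) \<le> (\<Sum>j=1..k. 1 / (1 - x) ^ j)"
        using x assms by (intro sum_mono) (auto simp: divide_simps power_le_one)
      then show ?thesis by simp
    qed
    then have "1 / real k * (\<Sum>j=1..k. 1 / (1 - x) ^ j) - 1 \<ge> 0"
      using False by (simp add: field_simps)
    ultimately show "\<exists>y. ((\<lambda>x. bohr_F k x - x) has_field_derivative y) (at x) \<and> 0 \<le> y" by blast
  qed
  then show ?thesis by (simp add: bohr_F_at_0)
qed

lemma continuous_on_bohr_F:
  assumes "b < 1"
  shows "continuous_on {0..b} (bohr_F k)"
proof (cases "k = 0")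
  case True
  have "uniform_limit {0..b} (\<lambda>n x. \<Sum>i<n. x ^ Suc i / (real (Suc i))\<^sup>2) (\<lambda>x. \<Sum>i. x ^ Suc i / (real (Suc i))\<^sup>2) sequentially"
    by (rule Weierstrass_m_test[OF _ summable_inverse_squares_Suc])
      (use assms in \<open>auto simp: divide_simps power_le_one simp del: of_nat_Suc power_Suc\<close>)
  then have "continuous_on {0..b} (\<lambda>x. \<Sum>i. x ^ Suc i / (real (Suc i))\<^sup>2)"
    by (rule uniform_limit_theorem[rotated])
      (auto intro!: always_eventually continuous_intros simp del: of_nat_Suc power_Suc)
  moreover have "bohr_F k = (\<lambda>x. \<Sum>i. x ^ Suc i / (real (Suc i))\<^sup>2)"
    using True bohr_F_0 by auto
  ultimately show ?thesis by simp
next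
  case False
  show ?thesis
    by (rule DERIV_continuous_on[OF DERIV_subset[OF has_field_derivative_bohr_F]])
      (use assms False in auto)
qed

lemma r2_function_strict_mono:
  fixes x y :: real
  assumes "0 \<le> x" "x < y" "y < 1"
  shows "x * bohr_F k x - 1 + x < y * bohr_F k y - 1 + y"
proof -
  have "0 \<le> bohr_F k x" using bohr_F_ge[of x k] assms by linarith
  then have "x * bohr_F k x \<le> y * bohr_F k y"
    using assms by (intro mult_mono bohr_F_mono) auto
  with assms show ?thesis by linarith
qed

lemma ex1_r2_root: "\<exists>!r. r2_root k r"
  unfolding r2_root_def
\<comment> \<open>Since F_k(r) is at least r, the function is at least r^2 + r - 1, which is
  positive at 9/10 for every \<open>k\<close>.\<close>
proof (rule ex1_root_strict_mono[where b = "9/10"])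
  show "continuous_on {0..9/10} (\<lambda>r. r * bohr_F k r - 1 + r)"
    by (intro continuous_intros continuous_on_bohr_F) simp
  show "0 < (9/10) * bohr_F k (9/10) - 1 + 9/10"
    using bohr_F_ge[of "9/10" k] by simp
qed (use r2_function_strict_mono[of _ _ k] in auto)

lemma le_r2_imp:
  assumes "0 \<le> r" "r \<le> r2 k"
  shows "r < 1" "r * bohr_F k r \<le> 1 - r"
proof -
  have root: "r2_root k (r2 k)"
    unfolding r2_def by (rule theI'[OF ex1_r2_root])
  then show "r < 1" using assms by (simp add: r2_root_def)
  show "r * bohr_F k r \<le> 1 - r"
    using root r2_function_strict_mono[of r "r2 k" k] assms
    by (cases "r = r2 k") (auto simp: r2_root_def)
qed

section \<open>The Bohr inequality up to r1 and r2\<close>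

lemma bloch_seminorm_nonneg:
  assumes "f \<in> bloch_space \<nu>"
  shows "0 \<le> bloch_seminorm \<nu> f"
proof -
  have "0 \<le> bloch_weight \<nu> f 0" by (simp add: bloch_weight_def)
  also have "\<dots> \<le> bloch_seminorm \<nu> f" using assms by (intro bloch_weight_le_seminorm) auto
  finally show ?thesis .
qed

text \<open>Cauchy-Schwarz after splitting r^(n+1) as sqrt (w n) * sqrt (v n). The three cases below
  differ only in the choice of the weights; \<open>b\<close> will be the seminorm.\<close>

lemma bohr_sum_le_of_weighted_squares:
  fixes a :: "nat \<Rightarrow> complex" and w v :: "nat \<Rightarrow> real"
  assumes "0 \<le> r" "0 \<le> b"
    and v: "\<And>n. 0 \<le> v n" and w: "\<And>n. 0 \<le> w n"
    and wv: "\<And>n. w n * v n = r ^ (2 * Suc n)"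
    and A: "(\<Sum>n<N. (cmod (a (Suc n)))\<^sup>2 * w n) \<le> b\<^sup>2 * A"
    and V: "(\<Sum>n<N. v n) \<le> V"
    and AV: "A * V \<le> 1" and "0 \<le> A"
  shows "(\<Sum>n<N. cmod (a (Suc n)) * r ^ Suc n) \<le> b"
proof -
  have "sqrt (w n) * sqrt (v n) = r ^ Suc n" for n
    using wv[of n] assms(1)
    by (metis mult.commute power_mult real_sqrt_abs2 real_sqrt_mult real_sqrt_unique zero_le_power)
  then have "(\<Sum>n<N. cmod (a (Suc n)) * r ^ Suc n)\<^sup>2
      = (\<Sum>n<N. (cmod (a (Suc n)) * sqrt (w n)) * sqrt (v n))\<^sup>2"
    by (simp add: mult.assoc del: power_Suc)
  also have "\<dots> \<le> (\<Sum>n<N. (cmod (a (Suc n)) * sqrt (w n))\<^sup>2) * (\<Sum>n<N. (sqrt (v n))\<^sup>2)"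
    by (rule Cauchy_Schwarz_ineq_sum)
  also have "\<dots> = (\<Sum>n<N. (cmod (a (Suc n)))\<^sup>2 * w n) * (\<Sum>n<N. v n)"
    using v w by (simp add: power_mult_distrib)
  also have "\<dots> \<le> (b\<^sup>2 * A) * V"
    using A V v w \<open>0 \<le> A\<close> by (intro mult_mono) (auto intro!: sum_nonneg)
  also have "\<dots> \<le> b\<^sup>2"
    using mult_left_mono[OF AV, of "b\<^sup>2"] by (simp add: mult.assoc)
  finally show ?thesis using \<open>0 \<le> b\<close> by (rule power2_le_imp_le)
qed

lemma bohr_sum_le_r1:
  assumes f: "f \<in> bloch_space \<nu>"
    and sums: "\<And>z. z \<in> ball 0 1 \<Longrightarrow> (\<lambda>n. a n * z ^ n) sums f z"
    and "0 < \<nu>" "0 \<le> r" "r \<le> r1 \<nu>"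
  shows "(\<Sum>n<N. cmod (a (Suc n)) * r ^ Suc n) \<le> bloch_seminorm \<nu> f"
proof (rule bohr_sum_le_of_weighted_squares)
  note r = le_r1_imp[OF assms(3-5)]
  have r2: "r\<^sup>2 < 1" using r assms by (simp add: abs_square_less_1)
  \<comment> \<open>The first weight is that of the coefficient estimate at x = r^2. The second sums
    to at most r^2 pi^2/6, so \<open>A * V \<le> 1\<close> is the inequality from
    \<open>le_r1_imp\<close>.\<close>
  let ?w = "\<lambda>n. (real (Suc n))\<^sup>2 * (r\<^sup>2) ^ n"
  let ?v = "\<lambda>n. r\<^sup>2 * (1 / (real (Suc n))\<^sup>2)"
  show "(\<Sum>n<N. (cmod (a (Suc n)))\<^sup>2 * ?w n) \<le> (bloch_seminorm \<nu> f)\<^sup>2 * (1 - r\<^sup>2) powr (- 2 * \<nu>)"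
    using bloch_coefficient_sum_le[OF f sums _ r2, of N] by (simp add: mult_ac del: of_nat_Suc)
  show "(\<Sum>n<N. ?v n) \<le> r\<^sup>2 * (pi\<^sup>2 / 6)"
  proof -
    have "(\<Sum>n<N. 1 / (real (Suc n))\<^sup>2) \<le> (\<Sum>n. 1 / (real (Suc n))\<^sup>2)"
      by (intro sum_le_suminf summable_inverse_squares_Suc) auto
    also have "\<dots> = pi\<^sup>2 / 6" using inverse_squares_sums by (simp add: sums_iff add.commute)
    finally show ?thesis unfolding sum_distrib_left[symmetric] by (intro mult_left_mono) auto
  qed
  have "(1 - r\<^sup>2) powr (2 * \<nu>) > 0" using r2 by simp
  with r(2) show "(1 - r\<^sup>2) powr (- 2 * \<nu>) * (r\<^sup>2 * (pi\<^sup>2 / 6)) \<le> 1"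
    by (simp add: powr_minus field_simps)
  show "?w n * ?v n = r ^ (2 * Suc n)" for n
    by (simp add: power_mult del: of_nat_Suc) (simp add: power2_eq_square)
qed (use assms bloch_seminorm_nonneg in auto)

text \<open>The base is at most 1, so raising 2\<nu> to the integer k + 1 can only enlarge the
  negative power. This is where the upper bound on \<nu> enters.\<close>

lemma powr_minus_le_inverse_power:
  fixes x \<nu> :: real
  assumes "0 \<le> x" "x < 1" "2 * \<nu> \<le> real k + 1"
  shows "(1 - x) powr (- 2 * \<nu>) \<le> 1 / (1 - x) ^ Suc k"
proof -
  have "(1 - x) powr (- 2 * \<nu>) \<le> (1 - x) powr (- real (Suc k))"
    using assms by (intro powr_mono') auto
  also have "\<dots> = 1 / (1 - x) ^ Suc k"
    using assms by (simp only: powr_minus powr_realpow) (simp add: divide_inverse)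
  finally show ?thesis .
qed

lemma bohr_sum_le_r2_0:
  assumes f: "f \<in> bloch_space \<nu>"
    and sums: "\<And>z. z \<in> ball 0 1 \<Longrightarrow> (\<lambda>n. a n * z ^ n) sums f z"
    and "2 * \<nu> \<le> 1" "0 \<le> r" "r \<le> r2 0"
  shows "(\<Sum>n<N. cmod (a (Suc n)) * r ^ Suc n) \<le> bloch_seminorm \<nu> f"
proof (rule bohr_sum_le_of_weighted_squares)
  note r = le_r2_imp[OF assms(4,5)]
  \<comment> \<open>The estimate at x = r uses only r^n; the remaining r^(n+2), divided by (n+1)^2,
    sums to r F_0(r).\<close>
  let ?w = "\<lambda>n. (real (Suc n))\<^sup>2 * r ^ n"
  let ?v = "\<lambda>n. r * (r ^ Suc n / (real (Suc n))\<^sup>2)"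
  have "(\<Sum>n<N. (real (Suc n))\<^sup>2 * (cmod (a (Suc n)))\<^sup>2 * r ^ n)
      \<le> (bloch_seminorm \<nu> f)\<^sup>2 * (1 - r) powr (- 2 * \<nu>)"
    using bloch_coefficient_sum_le[OF f sums] r assms by simp
  also have "\<dots> \<le> (bloch_seminorm \<nu> f)\<^sup>2 * (1 / (1 - r))"
    using powr_minus_le_inverse_power[of r \<nu> 0] r assms by (intro mult_left_mono) auto
  finally show "(\<Sum>n<N. (cmod (a (Suc n)))\<^sup>2 * ?w n) \<le> (bloch_seminorm \<nu> f)\<^sup>2 * (1 / (1 - r))"
    by (simp add: mult_ac del: of_nat_Suc)
  show "(\<Sum>n<N. ?v n) \<le> r * bohr_F 0 r"
  proof -
    have "(\<Sum>n<N. r ^ Suc n / (real (Suc n))\<^sup>2) \<le> bohr_F 0 r"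
      unfolding bohr_F_0 using r assms
      by (intro sum_le_suminf summable_bohr_F_0) (auto simp del: of_nat_Suc)
    then show ?thesis
      unfolding sum_distrib_left[symmetric] using assms by (intro mult_left_mono) auto
  qed
  show "1 / (1 - r) * (r * bohr_F 0 r) \<le> 1" using r by (simp add: field_simps)
  show "?w n * ?v n = r ^ (2 * Suc n)" for n
    by (simp add: mult_2 power_add del: of_nat_Suc)
  show "0 \<le> 1 / (1 - r)" using r by simp
qed (use assms bloch_seminorm_nonneg in auto)

text \<open>A finite geometric series with ratio 1/(1 - x). It identifies x k F_k'(x) with the
  expression that the first integration produces.\<close>

lemma geometric_sum_inverse:
  fixes x :: real
  assumes "x < 1"
  shows "x * (\<Sum>j=1..k. 1 / (1 - x) ^ j) = 1 / (1 - x) ^ k - 1"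
proof (induction k)
  case (Suc k)
  then have "x * (\<Sum>j=1..Suc k. 1 / (1 - x) ^ j) = 1 / (1 - x) ^ k - 1 + x / (1 - x) ^ Suc k"
    by (simp add: distrib_left)
  also have "\<dots> = 1 / (1 - x) ^ Suc k - 1"
    using assms by (simp add: field_simps)
  finally show ?case .
qed simp

text \<open>The bound on \<open>\<Sum> n\<^sup>2 |a\<^sub>n|\<^sup>2 x^(n-1)\<close> is integrated twice, the second time after division
  by \<open>x\<close>; the result on the right-hand side is the function \<open>F\<^sub>k\<close>.\<close>

lemma coefficient_squares_sum_le_bohr_F:
  fixes c :: "nat \<Rightarrow> real" and B :: real
  assumes bound: "\<And>x. 0 \<le> x \<Longrightarrow> x < 1 \<Longrightarrow>
      (\<Sum>n<N. (real (Suc n))\<^sup>2 * c n * x ^ n) \<le> B * (1 / (1 - x) ^ Suc k)"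
    and "0 < k" "0 \<le> r" "r < 1"
  shows "(\<Sum>n<N. c n * r ^ Suc n) \<le> B * bohr_F k r"
proof -
  \<comment> \<open>\<open>S0\<close> is the sum to be bounded; \<open>S1\<close> is its derivative,
    and \<open>S2\<close> is the derivative of x S1(x).\<close>
  define S0 where "S0 x = (\<Sum>n<N. c n * x ^ Suc n)" for x
  define S1 where "S1 x = (\<Sum>n<N. real (Suc n) * c n * x ^ n)" for x
  define S2 where "S2 x = (\<Sum>n<N. (real (Suc n))\<^sup>2 * c n * x ^ n)" for x
  have pow: "((\<lambda>x. C * x ^ Suc n) has_field_derivative C * (real (Suc n) * x ^ n)) (at x)"
    for C x :: real and n
    using DERIV_cmult[OF DERIV_pow[of "Suc n" x], of C] by (simp del: of_nat_Suc power_Suc)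
  have d0: "(S0 has_field_derivative S1 x) (at x)" for x
  proof -
    have "((\<lambda>x. \<Sum>n<N. c n * x ^ Suc n) has_field_derivative (\<Sum>n<N. c n * (real (Suc n) * x ^ n))) (at x)"
      by (intro DERIV_sum pow)
    then show ?thesis by (simp add: S0_def[abs_def] S1_def mult_ac del: of_nat_Suc power_Suc)
  qed
  have d1: "((\<lambda>x. x * S1 x) has_field_derivative S2 x) (at x)" for x
  proof -
    have "((\<lambda>x. \<Sum>n<N. (real (Suc n) * c n) * x ^ Suc n) has_field_derivative
        (\<Sum>n<N. (real (Suc n) * c n) * (real (Suc n) * x ^ n))) (at x)"
      by (intro DERIV_sum pow)
    then show ?thesis
      by (simp add: S1_def S2_def sum_distrib_left mult_ac power2_eq_square del: of_nat_Suc)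
  qed
  \<comment> \<open>First integration, carried out as monotonicity of the difference of the two
    sides, which vanishes at 0.\<close>
  have first: "x * S1 x \<le> B * ((1 / (1 - x) ^ k - 1) / real k)" if x: "0 \<le> x" "x < 1" for x
  proof -
    have "B * ((1 / (1 - 0) ^ k - 1) / real k) - 0 * S1 0
        \<le> B * ((1 / (1 - x) ^ k - 1) / real k) - x * S1 x"
    proof (rule DERIV_nonneg_imp_nondecreasing[OF x(1)])
      fix t assume t: "0 \<le> t" "t \<le> x"
      have "((\<lambda>x. 1 / (1 - x) ^ k) has_field_derivative real k * (1 / (1 - t) ^ Suc k)) (at t)"
        using t x by (intro has_field_derivative_inverse_power) auto
      then have "((\<lambda>x. B * ((1 / (1 - x) ^ k - 1) / real k) - x * S1 x) has_field_derivative
          B * ((real k * (1 / (1 - t) ^ Suc k) - 0) / real k) - S2 t) (at t)"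
        by (intro DERIV_cmult DERIV_cdivide DERIV_diff DERIV_const d1)
      moreover have "B * ((real k * (1 / (1 - t) ^ Suc k) - 0) / real k) - S2 t \<ge> 0"
        using bound[of t] t x \<open>0 < k\<close> by (simp add: S2_def)
      ultimately show "\<exists>y. ((\<lambda>x. B * ((1 / (1 - x) ^ k - 1) / real k) - x * S1 x)
          has_field_derivative y) (at t) \<and> 0 \<le> y" by blast
    qed
    then show ?thesis by simp
  qed
  have "B * bohr_F k 0 - S0 0 \<le> B * bohr_F k r - S0 r"
  proof (rule DERIV_nonneg_imp_nondecreasing[OF \<open>0 \<le> r\<close>])
    fix t assume t: "0 \<le> t" "t \<le> r"
    let ?D = "B * (1 / real k * (\<Sum>j=1..k. 1 / (1 - t) ^ j)) - S1 t"
    have "((\<lambda>x. B * bohr_F k x - S0 x) has_field_derivative ?D) (at t)"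
      using t assms by (intro DERIV_cmult DERIV_diff d0 has_field_derivative_bohr_F) auto
    moreover have "0 \<le> ?D"
    \<comment> \<open>At 0 the estimate \<open>first\<close> cannot be divided by \<open>t\<close>;
      there only the constant terms of \<open>S1\<close> and \<open>S2\<close> survive, and they
      agree.\<close>
    proof (cases "t = 0")
      case True
      have "S1 0 = S2 0"
        unfolding S1_def S2_def by (intro sum.cong refl) (auto simp: power_0_left)
      also have "\<dots> \<le> B" using bound[of 0] by (simp add: S2_def)
      finally show ?thesis using True \<open>0 < k\<close> by simp
    next
      case False
      then have "0 < t" using t by simp
      have "t * ?D = B * ((1 / (1 - t) ^ k - 1) / real k) - t * S1 t"
        using geometric_sum_inverse[of t k, symmetric] t assms by (simp add: algebra_simps)
      with first[of t] t assms have "0 \<le> t * ?D" by simp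
      with \<open>0 < t\<close> show ?thesis by (simp add: zero_le_mult_iff)
    qed
    ultimately show "\<exists>y. ((\<lambda>x. B * bohr_F k x - S0 x) has_field_derivative y) (at t) \<and> 0 \<le> y"
      by blast
  qed
  then show ?thesis by (simp add: S0_def bohr_F_at_0)
qed

text \<open>Both weights are r^(n+1): the squares sum to at most the squared seminorm times F_k(r),
  and the geometric series to at most r/(1 - r). The product condition is r F_k(r) \<le> 1 -
  r.\<close>

lemma bohr_sum_le_r2_pos:
  assumes f: "f \<in> bloch_space \<nu>"
    and sums: "\<And>z. z \<in> ball 0 1 \<Longrightarrow> (\<lambda>n. a n * z ^ n) sums f z"
    and "0 < k" "2 * \<nu> \<le> real k + 1" "0 \<le> r" "r \<le> r2 k"
  shows "(\<Sum>n<N. cmod (a (Suc n)) * r ^ Suc n) \<le> bloch_seminorm \<nu> f"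
proof (rule bohr_sum_le_of_weighted_squares)
  note r = le_r2_imp[OF assms(5,6)]
  show "(\<Sum>n<N. (cmod (a (Suc n)))\<^sup>2 * r ^ Suc n) \<le> (bloch_seminorm \<nu> f)\<^sup>2 * bohr_F k r"
  proof (rule coefficient_squares_sum_le_bohr_F)
    fix x :: real assume x: "0 \<le> x" "x < 1"
    have "(\<Sum>n<N. (real (Suc n))\<^sup>2 * (cmod (a (Suc n)))\<^sup>2 * x ^ n)
        \<le> (bloch_seminorm \<nu> f)\<^sup>2 * (1 - x) powr (- 2 * \<nu>)"
      by (rule bloch_coefficient_sum_le[OF f sums x])
    also have "\<dots> \<le> (bloch_seminorm \<nu> f)\<^sup>2 * (1 / (1 - x) ^ Suc k)"
      using powr_minus_le_inverse_power[of x \<nu> k] x assms by (intro mult_left_mono) auto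
    finally show "(\<Sum>n<N. (real (Suc n))\<^sup>2 * (cmod (a (Suc n)))\<^sup>2 * x ^ n)
        \<le> (bloch_seminorm \<nu> f)\<^sup>2 * (1 / (1 - x) ^ Suc k)" .
  qed (use assms r in auto)
  show "(\<Sum>n<N. r ^ Suc n) \<le> r * (1 / (1 - r))"
  proof -
    have "(\<Sum>n<N. r ^ n) \<le> (\<Sum>n. r ^ n)"
      using r assms by (intro sum_le_suminf summable_geometric) auto
    also have "\<dots> = 1 / (1 - r)" using r assms by (intro suminf_geometric) auto
    finally show ?thesis
      unfolding power_Suc sum_distrib_left[symmetric] using assms by (intro mult_left_mono) auto
  qed
  show "bohr_F k r * (r * (1 / (1 - r))) \<le> 1" using r by (simp add: field_simps)
  show "r ^ Suc n * r ^ Suc n = r ^ (2 * Suc n)" for n by (simp add: mult_2 power_add)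
  show "0 \<le> bohr_F k r" using bohr_F_ge[of r k] r assms by linarith
qed (use assms bloch_seminorm_nonneg in auto)

text \<open>The constant term contributes |f(0)| and the others at most the seminorm, so every
  partial sum is bounded by the norm. Nonnegative terms then give convergence as well.\<close>

lemma bohr_inequality_upto_r1_r2:
  assumes "0 < \<nu>" "2 * \<nu> \<le> real k + 1"
  shows "bohr_inequality_upto \<nu> (max (r1 \<nu>) (r2 k))"
  unfolding bohr_inequality_upto_def
proof (intro allI impI, elim conjE)
  fix f :: "complex \<Rightarrow> complex" and a :: "nat \<Rightarrow> complex" and r :: real
  assume f: "f \<in> bloch_space \<nu>" and norm: "bloch_norm \<nu> f \<le> 1"
    and sums': "\<forall>z\<in>ball 0 1. (\<lambda>n. a n * z ^ n) sums f z"
    and r: "0 \<le> r" "r \<le> max (r1 \<nu>) (r2 k)"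
  have sums: "(\<lambda>n. a n * z ^ n) sums f z" if "z \<in> ball 0 1" for z using sums' that by blast
  have tail: "(\<Sum>n<N. cmod (a (Suc n)) * r ^ Suc n) \<le> bloch_seminorm \<nu> f" for N
  proof (cases "r \<le> r1 \<nu>")
    case True
    then show ?thesis using bohr_sum_le_r1[OF f sums] assms r by blast
  next
    case False
    then have "r \<le> r2 k" using r by simp
    then show ?thesis
      using bohr_sum_le_r2_0[OF f sums, of r] bohr_sum_le_r2_pos[OF f sums, of k r] assms r
      by (cases "k = 0") auto
  qed
  have a0: "a 0 = f 0" using sums[of 0] powser_sums_zero_iff[of a "f 0"] by simp
  have bound: "(\<Sum>n<N. cmod (a n) * r ^ n) \<le> 1" for N
  proof (cases N)
    case (Suc M)
    have "(\<Sum>n<N. cmod (a n) * r ^ n) = cmod (f 0) + (\<Sum>n<M. cmod (a (Suc n)) * r ^ Suc n)"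
      unfolding Suc sum.lessThan_Suc_shift by (simp add: a0)
    then show ?thesis using tail[of M] norm by (simp add: bloch_norm_def)
  qed simp
  have nonneg: "0 \<le> cmod (a n) * r ^ n" for n using r by simp
  have "summable (\<lambda>n. cmod (a n) * r ^ n)"
    by (rule summableI_nonneg_bounded[OF nonneg bound])
  then show "summable (\<lambda>n. cmod (a n) * r ^ n) \<and> (\<Sum>n. cmod (a n) * r ^ n) \<le> 1"
    using suminf_le_const bound by blast
qed

section \<open>Functions that violate the inequality at r3\<close>

lemma bloch_space_unit_ballI:
  assumes hol: "f holomorphic_on ball 0 1" and "f 0 = 0"
    and weight: "\<And>z. z \<in> ball 0 1 \<Longrightarrow> bloch_weight \<nu> f z \<le> 1"
  shows "f \<in> bloch_space \<nu>" "bloch_norm \<nu> f \<le> 1"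
proof -
  show "f \<in> bloch_space \<nu>"
    using hol weight by (auto simp: bloch_space_def analytic_on_open intro!: bdd_aboveI2[where M = 1])
  have "bloch_seminorm \<nu> f \<le> 1"
    unfolding bloch_seminorm_def using weight by (intro cSUP_least) auto
  then show "bloch_norm \<nu> f \<le> 1" by (simp add: bloch_norm_def \<open>f 0 = 0\<close>)
qed

text \<open>The linear term of the majorant series is kept exactly, and the terms of degree at least
  2 are bounded below by the modulus of their sum. Splitting there keeps a negative linear
  coefficient from cancelling.\<close>

lemma bohr_inequality_uptoD:
  assumes bohr: "bohr_inequality_upto \<nu> R" and R: "0 \<le> R" "R < 1"
    and hol: "f holomorphic_on ball 0 1" and "f 0 = 0"
    and weight: "\<And>z. z \<in> ball 0 1 \<Longrightarrow> bloch_weight \<nu> f z \<le> 1"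
  shows "cmod (deriv f 0) * R + cmod (f (of_real R) - deriv f 0 * of_real R) \<le> 1"
proof -
  define a where "a n = (deriv ^^ n) f 0 / fact n" for n
  have sums: "(\<lambda>n. a n * z ^ n) sums f z" if "z \<in> ball 0 1" for z
    using holomorphic_power_series[OF hol that] by (simp add: a_def)
  have S: "summable (\<lambda>n. cmod (a n) * R ^ n)" "(\<Sum>n. cmod (a n) * R ^ n) \<le> 1"
    using bohr R sums bloch_space_unit_ballI[OF hol assms(5) weight]
    unfolding bohr_inequality_upto_def by blast+
  have a01: "a 0 = 0" "a 1 = deriv f 0" by (simp_all add: a_def assms(5))
  have sm: "summable (\<lambda>n. cmod (a n * of_real R ^ n))"
    using S(1) R by (simp add: norm_mult norm_power)
  have sm2: "summable (\<lambda>n. cmod (a (n + 2) * of_real R ^ (n + 2)))"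
    using sm by (subst summable_iff_shift)
  have "f (of_real R) - deriv f 0 * of_real R = (\<Sum>n. a (n + 2) * of_real R ^ (n + 2))"
    using suminf_split_initial_segment[OF summable_norm_cancel[OF sm], of 2] sums[of "of_real R"] R a01
    by (simp add: sums_iff numeral_2_eq_2 diff_eq_eq)
  then have "cmod (f (of_real R) - deriv f 0 * of_real R) \<le> (\<Sum>n. cmod (a (n + 2) * of_real R ^ (n + 2)))"
    using summable_norm[OF sm2] by simp
  also have "\<dots> = (\<Sum>n. cmod (a n * of_real R ^ n)) - cmod (deriv f 0) * R"
    using suminf_split_initial_segment[OF sm, of 2] R a01
    by (simp add: numeral_2_eq_2 norm_mult norm_power)
  also have "(\<Sum>n. cmod (a n * of_real R ^ n)) \<le> 1"
    using S(2) R by (simp add: norm_mult norm_power)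
  finally show ?thesis by simp
qed

text \<open>The maximum is at s = 1/sqrt 3, so the difference of the two sides has a double zero
  there and is a multiple of (t - s)^2 (t + 2s).\<close>

lemma bonk_cubic_bound:
  fixes t :: real
  assumes "0 \<le> t"
  shows "3 * sqrt 3 / 2 * (t * (1 - t\<^sup>2)) \<le> 1"
proof -
  define s where "s = sqrt 3 / 3"
  have s2: "s * s = 1 / 3" by (simp add: s_def)
  have "0 \<le> (t - s)\<^sup>2 * (t + 2 * s)" using assms by (simp add: s_def)
  also have "\<dots> = t ^ 3 - 3 * (s * s) * t + 2 * (s * s) * s"
    by (simp add: power2_eq_square power3_eq_cube algebra_simps)
  finally have "t * (1 - t\<^sup>2) \<le> 2 / 3 * s"
    unfolding s2 by (simp add: power2_eq_square power3_eq_cube algebra_simps)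
  then have "3 * sqrt 3 / 2 * (t * (1 - t\<^sup>2)) \<le> 3 * sqrt 3 / 2 * (2 / 3 * s)"
    by (intro mult_left_mono) auto
  also have "\<dots> = 1" by (simp add: s_def)
  finally show ?thesis .
qed

text \<open>The equality case of Schwarz-Pick for a disk automorphism, cleared of
  denominators.\<close>

lemma cmod_sq_moebius_identity:
  fixes z :: complex and a :: real
  shows "(cmod (1 - of_real a * z))\<^sup>2 - (cmod (z - of_real a))\<^sup>2 = (1 - (cmod z)\<^sup>2) * (1 - a\<^sup>2)"
  unfolding cmod_power2 by (simp add: power2_eq_square algebra_simps)

text \<open>The square of a disk automorphism, normalised to have Bloch seminorm 1. The parameter
  is a rational number close to the one that maximises the majorant series at 0.624162.\<close>

lemma not_bohr_inequality_upto_const: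
  assumes "1 \<le> \<nu>"
  shows "\<not> bohr_inequality_upto \<nu> 0.624162"
proof
  assume bohr: "bohr_inequality_upto \<nu> 0.624162"
  define a :: real where "a = 151 / 400"
  define C :: real where "C = 3 * sqrt 3 / 4"
  define \<phi> :: "complex \<Rightarrow> complex" where "\<phi> z = (z - of_real a) / (1 - of_real a * z)" for z
  define f :: "complex \<Rightarrow> complex" where "f z = of_real C * ((\<phi> z)\<^sup>2 - of_real (a\<^sup>2))" for z
  have C: "0 < C" by (simp add: C_def)
  have nz: "1 - of_real a * z \<noteq> 0" if "z \<in> ball 0 1" for z :: complex
  proof
    assume "1 - of_real a * z = 0"
    then have "cmod (of_real a * z) = 1" by simp
    with that show False by (simp add: norm_mult a_def)
  qed
  have d: "(f has_field_derivative of_real (2 * C) * \<phi> z * (of_real (1 - a\<^sup>2) / (1 - of_real a * z)\<^sup>2)) (at z)"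
    if "z \<in> ball 0 1" for z
  proof -
    have "(\<phi> has_field_derivative of_real (1 - a\<^sup>2) / (1 - of_real a * z)\<^sup>2) (at z)"
      unfolding \<phi>_def[abs_def] using nz[OF that]
      by (auto intro!: derivative_eq_intros simp: power2_eq_square algebra_simps)
    from DERIV_cmult[OF DERIV_diff[OF DERIV_power[OF this, of 2] DERIV_const[of "of_real (a\<^sup>2)"]], of "of_real C"]
    show ?thesis by (simp add: f_def[abs_def] mult_ac)
  qed
  have df: "deriv f z = of_real (2 * C) * \<phi> z * (of_real (1 - a\<^sup>2) / (1 - of_real a * z)\<^sup>2)"
    if "z \<in> ball 0 1" for z
    using d[OF that] by (rule DERIV_imp_deriv)
  have weight: "bloch_weight \<nu> f z \<le> 1" if z: "z \<in> ball 0 1" for z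
  proof -
    define t where "t = cmod (\<phi> z)"
    define u where "u = cmod (1 - of_real a * z)"
    have "0 < u" using nz[OF z] by (simp add: u_def)
    have "t * u = cmod (z - of_real a)"
      using nz[OF z] by (simp add: t_def u_def \<phi>_def norm_divide)
    then have "u\<^sup>2 - (t * u)\<^sup>2 = (1 - (cmod z)\<^sup>2) * (1 - a\<^sup>2)"
      using cmod_sq_moebius_identity[of a z] by (simp add: u_def)
    \<comment> \<open>This is (1 - |z|^2) |\<phi>'(z)| = 1 - |\<phi>(z)|^2; it reduces the weight to
      a function of \<open>t\<close> alone.\<close>
    then have tu: "(1 - (cmod z)\<^sup>2) * ((1 - a\<^sup>2) / u\<^sup>2) = 1 - t\<^sup>2"
      using \<open>0 < u\<close> by (simp add: field_simps)
    have z2: "0 < 1 - (cmod z)\<^sup>2" using z by (simp add: abs_square_less_1)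
    \<comment> \<open>As \<nu> is at least 1, the weight is largest for exponent 1, so one function
      serves all \<nu>.\<close>
    have "(1 - (cmod z)\<^sup>2) powr \<nu> \<le> (1 - (cmod z)\<^sup>2) powr 1"
      using z2 assms by (intro powr_mono') auto
    then have "bloch_weight \<nu> f z \<le> (1 - (cmod z)\<^sup>2) * cmod (deriv f z)"
      unfolding bloch_weight_def using z2 by (intro mult_right_mono) auto
    also have "cmod (deriv f z) = 2 * C * t * ((1 - a\<^sup>2) / u\<^sup>2)"
    proof -
      have "cmod (of_real (1 - a\<^sup>2)) = 1 - a\<^sup>2" unfolding norm_of_real by (simp add: a_def power2_eq_square)
      then show ?thesis
        using C by (simp add: df[OF z] norm_mult norm_divide norm_power t_def u_def del: of_real_diff of_real_mult)
    qed
    also have "(1 - (cmod z)\<^sup>2) * (2 * C * t * ((1 - a\<^sup>2) / u\<^sup>2))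
        = 2 * C * t * ((1 - (cmod z)\<^sup>2) * ((1 - a\<^sup>2) / u\<^sup>2))"
      by (simp only: mult_ac)
    also have "\<dots> = 3 * sqrt 3 / 2 * (t * (1 - t\<^sup>2))"
      unfolding tu by (simp add: C_def)
    also have "\<dots> \<le> 1" by (rule bonk_cubic_bound) (simp add: t_def)
    finally show ?thesis .
  qed
  define R :: real where "R = 0.624162"
  define \<psi> where "\<psi> = (R - a) / (1 - a * R)"
  have le: "cmod (deriv f 0) * R + cmod (f (of_real R) - deriv f 0 * of_real R) \<le> 1"
  proof (rule bohr_inequality_uptoD[OF _ _ _ _ _ weight])
    show "f holomorphic_on ball 0 1"
      using d by (meson holomorphic_on_open open_ball)
    show "f 0 = 0" by (simp add: f_def \<phi>_def)
  qed (use bohr in \<open>auto simp: R_def\<close>)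
  have d0: "deriv f 0 = of_real (- 2 * C * a * (1 - a\<^sup>2))"
    using df[of 0] by (simp add: \<phi>_def)
  have fR: "f (of_real R) = of_real (C * (\<psi>\<^sup>2 - a\<^sup>2))"
    by (simp add: f_def \<phi>_def \<psi>_def)
  \<comment> \<open>The linear coefficient is negative: removing it from f(R) and adding its modulus
    counts it twice, hence the factor 4 below.\<close>
  have "f (of_real R) - deriv f 0 * of_real R = of_real (C * (\<psi>\<^sup>2 - a\<^sup>2 + 2 * a * (1 - a\<^sup>2) * R))"
    unfolding d0 fR by (simp add: algebra_simps)
  moreover have "cmod (deriv f 0) = 2 * C * a * (1 - a\<^sup>2)"
    unfolding d0 norm_of_real using C by (simp add: a_def abs_mult power2_eq_square)
  ultimately have "2 * C * a * (1 - a\<^sup>2) * R + C * (\<psi>\<^sup>2 - a\<^sup>2 + 2 * a * (1 - a\<^sup>2) * R) \<le> 1"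
    using le by (simp only: norm_of_real)
  then have CX: "C * (\<psi>\<^sup>2 - a\<^sup>2 + 4 * a * (1 - a\<^sup>2) * R) \<le> 1"
    by (simp add: algebra_simps)
  \<comment> \<open>Squaring removes sqrt 3: as C^2 = 27/16, a contradiction needs only X^2 > 16/27,
    a comparison of rationals.\<close>
  define X where "X = \<psi>\<^sup>2 - a\<^sup>2 + 4 * a * (1 - a\<^sup>2) * R"
  have X: "0 < X" "16 / 27 < X * X"
    unfolding X_def \<psi>_def a_def R_def by (simp_all add: power2_eq_square field_simps)
  have "C * C = 27 / 16" by (simp add: C_def)
  moreover have "(C * X) * (C * X) = (C * C) * (X * X)" by (simp only: mult_ac)
  ultimately have "(C * X) * (C * X) = 27 / 16 * (X * X)" by simp
  with X(2) have "1 < (C * X) * (C * X)" by linarith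
  moreover have "(C * X) * (C * X) \<le> 1 * 1"
    using CX X(1) C unfolding X_def[symmetric] by (intro mult_mono) auto
  ultimately show False by simp
qed

lemma cmod_exp_Ln:
  assumes "w \<noteq> 0"
  shows "cmod (exp (of_real s * Ln w)) = cmod w powr s"
  using assms by (simp add: powr_def)

lemma has_real_derivative_Re_of_real:
  assumes "(f has_field_derivative D) (at (of_real x))"
  shows "((\<lambda>x. Re (f (of_real x))) has_real_derivative Re D) (at x)"
  using bounded_linear.has_vector_derivative[OF bounded_linear_Re has_vector_derivative_real_field[OF assms]]
  by (simp add: has_real_derivative_iff_has_vector_derivative)

text \<open>The extremal function is the primitive of \<open>(1 - z\<^sup>2)\<close> to the power \<open>-\<nu>\<close>: its weight is at
  most 1 because \<open>1 - |z|\<^sup>2 \<le> |1 - z\<^sup>2|\<close>. On the real axis it exceeds the primitive of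
  \<open>x (1 - x\<^sup>2)\<close> to the power \<open>-\<nu>\<close>, which has the value 1 at the radius in question.\<close>

lemma not_bohr_inequality_upto_sqrt:
  assumes \<nu>: "1 < \<nu>"
  shows "\<not> bohr_inequality_upto \<nu> (sqrt (1 - (2 * \<nu> - 1) powr (- 1 / (\<nu> - 1))))"
    (is "\<not> bohr_inequality_upto \<nu> ?R")
proof
  assume bohr: "bohr_inequality_upto \<nu> ?R"
  define q where "q = (2 * \<nu> - 1) powr (- 1 / (\<nu> - 1))"
  define R where "R = sqrt (1 - q)"
  have q: "0 < q" "q < 1"
    using \<nu> powr_less_mono[of "- 1 / (\<nu> - 1)" 0 "2 * \<nu> - 1"] by (auto simp: q_def)
  have R: "0 < R" "R < 1" "1 - R\<^sup>2 = q" using q by (auto simp: R_def)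
  \<comment> \<open>The radius is chosen for this identity, which makes the comparison primitive
    equal to 1 at \<open>R\<close>.\<close>
  have q_powr: "q powr (1 - \<nu>) = 2 * \<nu> - 1"
  proof -
    have "- 1 / (\<nu> - 1) * (1 - \<nu>) = 1" using \<nu> by (simp add: field_simps)
    then show ?thesis unfolding q_def powr_powr using \<nu> by simp
  qed
  \<comment> \<open>On the disk 1 - z^2 has positive real part, so the principal logarithm is
    holomorphic there.\<close>
  define g :: "complex \<Rightarrow> complex" where "g z = exp (of_real (- \<nu>) * Ln (1 - z\<^sup>2))" for z
  have Re_pos: "0 < Re (1 - z\<^sup>2)" if "z \<in> ball 0 1" for z
  proof -
    have "Re (z\<^sup>2) \<le> cmod (z\<^sup>2)" by (rule complex_Re_le_cmod)
    also have "\<dots> < 1" using that by (simp add: norm_power abs_square_less_1)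
    finally show ?thesis by simp
  qed
  have "g holomorphic_on ball 0 1"
    unfolding g_def using Re_pos
    by (intro holomorphic_intros) (auto simp: complex_nonpos_Reals_iff not_le dest!: Re_pos)
  then obtain F where F: "\<And>z. z \<in> ball 0 1 \<Longrightarrow> (F has_field_derivative g z) (at z within ball 0 1)"
    using holomorphic_convex_primitive'[of "ball 0 1" g] by auto
  define f where "f z = F z - F 0" for z
  have d: "(f has_field_derivative g z) (at z)" if "z \<in> ball 0 1" for z
    using DERIV_diff[OF F[OF that] DERIV_const[of "F 0"]] that
    by (simp add: f_def[abs_def] at_within_open[OF that])
  have weight: "bloch_weight \<nu> f z \<le> 1" if z: "z \<in> ball 0 1" for z
  proof -
    have z2: "0 < 1 - (cmod z)\<^sup>2" using z by (simp add: abs_square_less_1)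
    have le: "1 - (cmod z)\<^sup>2 \<le> cmod (1 - z\<^sup>2)"
      using norm_triangle_ineq2[of 1 "z\<^sup>2"] by (simp add: norm_power)
    have "1 - z\<^sup>2 \<noteq> 0" using Re_pos[OF z] by (metis less_irrefl zero_complex.simps(1))
    then have "bloch_weight \<nu> f z = (1 - (cmod z)\<^sup>2) powr \<nu> * cmod (1 - z\<^sup>2) powr (- \<nu>)"
      unfolding bloch_weight_def DERIV_imp_deriv[OF d[OF z]] g_def by (simp only: cmod_exp_Ln not_False_eq_True)
    also have "\<dots> \<le> cmod (1 - z\<^sup>2) powr \<nu> * cmod (1 - z\<^sup>2) powr (- \<nu>)"
      using z2 le \<nu> by (intro mult_right_mono powr_mono2) auto
    also have "\<dots> = 1" using \<open>1 - z\<^sup>2 \<noteq> 0\<close> by (simp flip: powr_add)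
    finally show ?thesis .
  qed
  have "cmod (deriv f 0) * R + cmod (f (of_real R) - deriv f 0 * of_real R) \<le> 1"
  proof (rule bohr_inequality_uptoD[OF _ _ _ _ _ weight])
    show "bohr_inequality_upto \<nu> R" using bohr by (simp add: R_def q_def)
    show "f holomorphic_on ball 0 1" using d by (meson holomorphic_on_open open_ball)
    show "f 0 = 0" by (simp add: f_def)
  qed (use R in auto)
  moreover have "cmod (f (of_real R))
      \<le> cmod (deriv f 0) * R + cmod (f (of_real R) - deriv f 0 * of_real R)"
    using norm_triangle_ineq[of "deriv f 0 * of_real R" "f (of_real R) - deriv f 0 * of_real R"] R
    by (simp add: norm_mult)
  ultimately have "Re (f (of_real R)) \<le> 1"
    using complex_Re_le_cmod[of "f (of_real R)"] by linarith
  \<comment> \<open>Both functions vanish at 0, and their difference has derivative (1 - x) (1 -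
    x^2)^(-\<nu>) > 0. Hence Re f(R) exceeds 1.\<close>
  moreover have "Re (f (of_real 0)) - ((1 - 0\<^sup>2) powr (1 - \<nu>) - 1) / (2 * (\<nu> - 1))
      < Re (f (of_real R)) - ((1 - R\<^sup>2) powr (1 - \<nu>) - 1) / (2 * (\<nu> - 1))"
  proof (rule DERIV_pos_imp_increasing[OF R(1)])
    fix x assume x: "0 \<le> x" "x \<le> R"
    then have x1: "x < 1" "x\<^sup>2 < 1" using R by (auto simp: abs_square_less_1)
    have "g (of_real x) = of_real ((1 - x\<^sup>2) powr (- \<nu>))"
    proof -
      have "1 - (complex_of_real x)\<^sup>2 = of_real (1 - x\<^sup>2)" by simp
      then show ?thesis
        using x1 by (simp add: g_def powr_def Ln_of_real del: of_real_diff flip: exp_of_real)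
    qed
    then have "((\<lambda>x. Re (f (of_real x))) has_real_derivative (1 - x\<^sup>2) powr (- \<nu>)) (at x)"
      using has_real_derivative_Re_of_real[OF d[of "of_real x"]] x x1 by simp
    moreover have "((\<lambda>x. ((1 - x\<^sup>2) powr (1 - \<nu>) - 1) / (2 * (\<nu> - 1))) has_real_derivative
        x * (1 - x\<^sup>2) powr (- \<nu>)) (at x)"
    proof -
      have "((\<lambda>x. (1 - x\<^sup>2) powr (1 - \<nu>)) has_real_derivative
          (1 - \<nu>) * (1 - x\<^sup>2) powr (1 - \<nu> - 1) * (- 2 * x)) (at x)"
        using x1 by (intro DERIV_fun_powr[THEN DERIV_cong]) (auto intro!: derivative_eq_intros)
      then have "((\<lambda>x. ((1 - x\<^sup>2) powr (1 - \<nu>) - 1) / (2 * (\<nu> - 1))) has_real_derivative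
          ((1 - \<nu>) * (1 - x\<^sup>2) powr (1 - \<nu> - 1) * (- 2 * x) - 0) / (2 * (\<nu> - 1))) (at x)"
        by (intro DERIV_cdivide DERIV_diff DERIV_const)
      moreover have "((1 - \<nu>) * (1 - x\<^sup>2) powr (1 - \<nu> - 1) * (- 2 * x) - 0) / (2 * (\<nu> - 1))
          = x * (1 - x\<^sup>2) powr (- \<nu>)"
        using \<nu> by (simp add: field_simps)
      ultimately show ?thesis by simp
    qed
    ultimately have "((\<lambda>x. Re (f (of_real x)) - ((1 - x\<^sup>2) powr (1 - \<nu>) - 1) / (2 * (\<nu> - 1)))
        has_real_derivative (1 - x\<^sup>2) powr (- \<nu>) - x * (1 - x\<^sup>2) powr (- \<nu>)) (at x)"
      by (rule DERIV_diff)
    moreover have "0 < (1 - x\<^sup>2) powr (- \<nu>) - x * (1 - x\<^sup>2) powr (- \<nu>)"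
    proof -
      have "(1 - x\<^sup>2) powr (- \<nu>) - x * (1 - x\<^sup>2) powr (- \<nu>) = (1 - x) * (1 - x\<^sup>2) powr (- \<nu>)"
        by (simp add: left_diff_distrib)
      also have "\<dots> > 0" using x1 by simp
      finally show ?thesis .
    qed
    ultimately show "\<exists>y. ((\<lambda>x. Re (f (of_real x)) - ((1 - x\<^sup>2) powr (1 - \<nu>) - 1) / (2 * (\<nu> - 1)))
        has_real_derivative y) (at x) \<and> 0 < y" by blast
  qed
  moreover have "((1 - R\<^sup>2) powr (1 - \<nu>) - 1) / (2 * (\<nu> - 1)) = 1"
    using \<nu> by (simp add: R(3) q_powr field_simps)
  ultimately show False by (simp add: f_def)
qed

text \<open>The minimum is one of the two radii, and each of them is excluded.\<close>

lemma not_bohr_inequality_upto_r3: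
  assumes "1 \<le> \<nu>"
  shows "\<not> bohr_inequality_upto \<nu> (r3 \<nu>)"
  using assms not_bohr_inequality_upto_const[of \<nu>] not_bohr_inequality_upto_sqrt[of \<nu>]
  by (cases "\<nu> = 1") (auto simp: r3_def min_def)

theorem theorem6:
  fixes \<nu> :: real and k :: nat
  assumes "\<nu> > 0"
    and "\<nu> \<in> {real k / 2 <.. (real k + 1) / 2}"
  shows "(\<exists>!r. r1_root \<nu> r) \<and> (\<exists>!r. r2_root k r)
    \<and> bohr_inequality_upto \<nu> (max (r1 \<nu>) (r2 k))
    \<and> (\<nu> \<ge> 1 \<longrightarrow> \<not> bohr_inequality_upto \<nu> (r3 \<nu>))"
  using assms ex1_r1_root[of \<nu>] ex1_r2_root[of k] bohr_inequality_upto_r1_r2[of \<nu> k]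
    not_bohr_inequality_upto_r3[of \<nu>]
  by (auto simp: field_simps)

end
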